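(* Let $m\ge 2$ be an integer and $n\ge 0$ an integer. If $t\in\mathbb{C}$ satisfies $p_m(n,t)=0$, then $|t|<4^{1/m}$.
   Context: The $m$-ary partition polynomials $p_m(n,t)$ are defined by the power series expansion $\prod_{j=0}^{\infty}\frac{1}{1-tq^{m^j}}=\sum_{n=0}^{\infty}p_m(n,t)q^n$; the coefficient of $t^j$ in $p_m(n,t)$ is the number of ways to write $n$ as a sum of exactly $j$ powers of $m$ (order irrelevant). *)

theory Defs
  imports "HOL-Analysis.Analysis" "HOL-Library.Multiset"
begin

text \<open>
  The ambient ring is \<open>\<complex>[t][[q]]\<close>: \<open>[:0, 1:]\<close> is the indeterminate \<open>t\<close> and \<open>fps_X\<close> is \<open>q\<close>.
  As \<open>\<complex>[t]\<close> is not a field, \<open>1 / (1 - t q\<^sup>k)\<close> is written with the ring-level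
  \<open>fps_right_inverse\<close>, whose second argument is the inverse of the constant coefficient.
\<close>

definition mary_factor :: "nat \<Rightarrow> complex poly fps" where
  "mary_factor k = fps_right_inverse (1 - fps_const [:0, 1:] * fps_X ^ k) 1"

text \<open>The infinite product is taken in the \<open>q\<close>-adic topology.\<close>

definition mary_partition_gf :: "nat \<Rightarrow> complex poly fps" where
  "mary_partition_gf m = (\<Prod>j. mary_factor (m ^ j))"

definition mary_partition_poly :: "nat \<Rightarrow> nat \<Rightarrow> complex poly" where
  "mary_partition_poly m n = fps_nth (mary_partition_gf m) n"


lemma mary_factor_inverse:
  assumes "k > 0"
  shows "(1 - fps_const [:0, 1:] * fps_X ^ k) * mary_factor k = 1"
  unfolding mary_factor_def using assms by (intro fps_right_inverse) simp

lemma mary_factor_nth: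
  assumes "k > 0"
  shows "fps_nth (mary_factor k) n = (if k dvd n then monom 1 (n div k) else 0)"
proof (induction n rule: less_induct)
  case (less n)
  have eq: "mary_factor k = 1 + fps_const [:0, 1:] * (fps_X ^ k * mary_factor k)"
    using mary_factor_inverse[OF assms] by (simp add: algebra_simps)
  have "fps_nth (mary_factor k) n =
      (if n = 0 then 1 else 0) + [:0, 1:] * (if n < k then 0 else fps_nth (mary_factor k) (n - k))"
    by (subst eq) (simp add: fps_X_power_mult_nth)
  also have "\<dots> = (if k dvd n then monom 1 (n div k) else 0)"
  proof (cases "n < k")
    case True
    then show ?thesis using assms by (auto simp: dvd_imp_le dest: dvd_imp_le)
  next
    case False
    then have "fps_nth (mary_factor k) (n - k) = (if k dvd n - k then monom 1 ((n - k) div k) else 0)"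
      using assms by (intro less) auto
    moreover have "n div k = Suc ((n - k) div k)"
      using False assms by (simp add: le_div_geq)
    moreover have "k dvd n - k \<longleftrightarrow> k dvd n"
      using False by (simp add: dvd_minus_self)
    ultimately show ?thesis using False assms by (simp add: monom_Suc)
  qed
  finally show ?case .
qed

lemma mary_partial_product_stable:
  assumes "m \<ge> 2" "n < N"
  shows "fps_nth (\<Prod>j<N. mary_factor (m ^ j)) n = fps_nth (\<Prod>j<Suc n. mary_factor (m ^ j)) n"
proof -
  have "Suc n \<le> N" using assms by simp
  then show ?thesis
  proof (induction N rule: dec_induct)
    case (step N)
    have lt: "n < m ^ N"
      using step.hyps assms(1) less_exp[of N] power_mono[of 2 m N] by linarith
    have nz: "fps_nth (mary_factor (m ^ N)) i = (if i = 0 then 1 else 0)" if "i \<le> n" for i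
      using that lt assms by (subst mary_factor_nth) (auto dest: dvd_imp_le)
    have "fps_nth (\<Prod>j<Suc N. mary_factor (m ^ j)) n =
        (\<Sum>i=0..n. fps_nth (\<Prod>j<N. mary_factor (m ^ j)) i * fps_nth (mary_factor (m ^ N)) (n - i))"
      by (simp add: fps_mult_nth)
    also have "\<dots> = (\<Sum>i=0..n. if i = n then fps_nth (\<Prod>j<N. mary_factor (m ^ j)) i else 0)"
      by (intro sum.cong refl) (auto simp: nz)
    also have "\<dots> = fps_nth (\<Prod>j<N. mary_factor (m ^ j)) n" by simp
    finally show ?case using step.IH by simp
  qed simp
qed

lemma mary_partition_gf_has_prod:
  assumes "m \<ge> 2"
  shows "(\<lambda>j. mary_factor (m ^ j)) has_prod mary_partition_gf m"
    and "mary_partition_poly m n = fps_nth (\<Prod>j<Suc n. mary_factor (m ^ j)) n"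
proof -
  define L where "L = Abs_fps (\<lambda>n. fps_nth (\<Prod>j<Suc n. mary_factor (m ^ j)) n)"
  have "(\<lambda>N. \<Prod>j\<le>N. mary_factor (m ^ j)) \<longlonglongrightarrow> L"
  proof (rule tendsto_fpsI)
    fix n
    show "\<forall>\<^sub>F N in sequentially. fps_nth (\<Prod>j\<le>N. mary_factor (m ^ j)) n = fps_nth L n"
      using eventually_ge_at_top[of n]
    proof eventually_elim
      case (elim N)
      then show ?case
        using mary_partial_product_stable[OF assms, of n "Suc N"]
        by (simp only: L_def fps_nth_Abs_fps lessThan_Suc_atMost less_Suc_eq_le)
    qed
  qed
  moreover have "fps_nth L 0 = 1" by (simp add: L_def mary_factor_nth)
  then have "L \<noteq> 0" by auto
  ultimately have L: "(\<lambda>j. mary_factor (m ^ j)) has_prod L"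
    by (simp add: has_prod_def raw_has_prod_def)
  then have eq: "mary_partition_gf m = L"
    unfolding mary_partition_gf_def using has_prod_unique by metis
  show "(\<lambda>j. mary_factor (m ^ j)) has_prod mary_partition_gf m"
    using L eq by simp
  show "mary_partition_poly m n = fps_nth (\<Prod>j<Suc n. mary_factor (m ^ j)) n"
    by (simp only: mary_partition_poly_def eq L_def fps_nth_Abs_fps)
qed

text \<open>
  Partitions of \<open>n\<close> into \<open>k\<close> powers of \<open>m\<close> with exponents below \<open>N\<close>, as multisets of exponents.
\<close>

definition mary_partitions :: "nat \<Rightarrow> nat \<Rightarrow> nat \<Rightarrow> nat \<Rightarrow> nat multiset set" where
  "mary_partitions m N n k =
     {M. set_mset M \<subseteq> {..<N} \<and> size M = k \<and> (\<Sum>i\<in>#M. m ^ i) = n}"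

lemma mary_partitions_0:
  "mary_partitions m 0 n k = (if n = 0 \<and> k = 0 then {{#}} else {})"
  by (auto simp: mary_partitions_def)

lemma mary_partitions_Suc:
  "mary_partitions m (Suc N) n k =
     (\<Union>c\<in>{c. c \<le> k \<and> c * m ^ N \<le> n}.
        (\<lambda>M. M + replicate_mset c N) ` mary_partitions m N (n - c * m ^ N) (k - c))"
    (is "?L = ?R")
proof (intro equalityI subsetI)
  fix M assume M: "M \<in> ?L"
  define c where "c = count M N"
  define M' where "M' = filter_mset (\<lambda>i. i \<noteq> N) M"
  have split: "M = M' + replicate_mset c N"
    unfolding M'_def c_def by (rule multiset_eqI) auto
  have "size M' + c = k" "(\<Sum>i\<in>#M'. m ^ i) + c * m ^ N = n"
    using M split by (auto simp: mary_partitions_def)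
  moreover have "set_mset M' \<subseteq> {..<N}"
    using M by (auto simp: M'_def mary_partitions_def less_Suc_eq)
  ultimately have "M' \<in> mary_partitions m N (n - c * m ^ N) (k - c)"
      "c \<in> {c. c \<le> k \<and> c * m ^ N \<le> n}"
    by (auto simp: mary_partitions_def)
  then show "M \<in> ?R" using split by blast
next
  fix M assume "M \<in> ?R"
  then show "M \<in> ?L"
    by (fastforce simp: mary_partitions_def split: if_splits)
qed

lemma finite_mary_partitions: "finite (mary_partitions m N n k)"
proof (induction N arbitrary: n k)
  case (Suc N)
  have "finite {c. c \<le> k \<and> c * m ^ N \<le> n}"
    by (rule finite_subset[of _ "{..k}"]) auto
  then show ?case using Suc by (simp add: mary_partitions_Suc)
qed (simp add: mary_partitions_0)

lemma card_mary_partitions_Suc: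
  "card (mary_partitions m (Suc N) n k) =
     (\<Sum>c | c \<le> k \<and> c * m ^ N \<le> n. card (mary_partitions m N (n - c * m ^ N) (k - c)))"
proof -
  have fin: "finite {c. c \<le> k \<and> c * m ^ N \<le> n}"
    by (rule finite_subset[of _ "{..k}"]) auto
  have cnt: "count M N = c"
    if "M \<in> (\<lambda>M. M + replicate_mset c N) ` mary_partitions m N a b" for M c a b
  proof -
    from that obtain M' where M': "M = M' + replicate_mset c N" "set_mset M' \<subseteq> {..<N}"
      by (auto simp: mary_partitions_def)
    then have "count M' N = 0" by (auto simp: not_in_iff[symmetric])
    then show ?thesis using M' by simp
  qed
  have "card (mary_partitions m (Suc N) n k) =
     (\<Sum>c | c \<le> k \<and> c * m ^ N \<le> n.
        card ((\<lambda>M. M + replicate_mset c N) ` mary_partitions m N (n - c * m ^ N) (k - c)))"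
    unfolding mary_partitions_Suc
  proof (rule card_UN_disjoint[OF fin], goal_cases)
    case 1
    then show ?case by (simp add: finite_mary_partitions)
  next
    case 2
    then show ?case using cnt by (metis (no_types, lifting) disjoint_iff)
  qed
  also have "\<dots> = (\<Sum>c | c \<le> k \<and> c * m ^ N \<le> n. card (mary_partitions m N (n - c * m ^ N) (k - c)))"
    by (intro sum.cong refl card_image) (auto simp: inj_on_def)
  finally show ?thesis .
qed

lemma coeff_mary_partial_product:
  assumes "m > 0"
  shows "coeff (fps_nth (\<Prod>j<N. mary_factor (m ^ j)) n) k = of_nat (card (mary_partitions m N n k))"
proof (induction N arbitrary: n k)
  case 0
  show ?case by (auto simp: mary_partitions_0 coeff_1)
next
  case (Suc N)
  define P where "P = (\<Prod>j<N. mary_factor (m ^ j))"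
  have pos: "m ^ N > 0" using assms by simp
  have "fps_nth (\<Prod>j<Suc N. mary_factor (m ^ j)) n =
      (\<Sum>i=0..n. fps_nth (mary_factor (m ^ N)) i * fps_nth P (n - i))"
    by (simp add: P_def mult.commute[of _ "mary_factor (m ^ N)"] fps_mult_nth)
  also have "\<dots> = (\<Sum>i\<in>(\<lambda>c. c * m ^ N) ` {c. c * m ^ N \<le> n}.
      fps_nth (mary_factor (m ^ N)) i * fps_nth P (n - i))"
    using pos by (intro sum.mono_neutral_right)
      (auto simp: mary_factor_nth image_iff mult.commute elim!: dvdE)
  also have "\<dots> = (\<Sum>c | c * m ^ N \<le> n. monom 1 c * fps_nth P (n - c * m ^ N))"
    using pos by (subst sum.reindex) (auto simp: inj_on_def mary_factor_nth)
  finally have "coeff (fps_nth (\<Prod>j<Suc N. mary_factor (m ^ j)) n) k =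
      (\<Sum>c | c * m ^ N \<le> n. if c \<le> k then coeff (fps_nth P (n - c * m ^ N)) (k - c) else 0)"
    by (auto simp: coeff_sum coeff_monom_mult intro!: sum.cong)
  also have "\<dots> = (\<Sum>c | c \<le> k \<and> c * m ^ N \<le> n. coeff (fps_nth P (n - c * m ^ N)) (k - c))"
  proof (rule sum.mono_neutral_cong_right)
    show "finite {c. c * m ^ N \<le> n}"
    proof (rule finite_subset)
      show "{c. c * m ^ N \<le> n} \<subseteq> {..n}"
      proof
        fix c assume "c \<in> {c. c * m ^ N \<le> n}"
        moreover have "c \<le> c * m ^ N" using assms by (simp add: Suc_le_eq)
        ultimately show "c \<in> {..n}" unfolding mem_Collect_eq atMost_iff by linarith
      qed
    qed simp
  qed auto
  also have "\<dots> = of_nat (card (mary_partitions m (Suc N) n k))"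
    by (simp add: card_mary_partitions_Suc P_def Suc.IH)
  finally show ?case .
qed

theorem coeff_mary_partition_poly:
  assumes "m \<ge> 2"
  shows "coeff (mary_partition_poly m n) k =
    of_nat (card {M :: nat multiset. size M = k \<and> (\<Sum>i\<in>#M. m ^ i) = n})"
proof -
  have "i < Suc n" if "(\<Sum>i\<in>#M. m ^ i) = n" "i \<in># M" for M i
  proof -
    have "m ^ i \<le> (\<Sum>i\<in>#M. m ^ i)"
      using that(2) by (auto dest!: multi_member_split)
    moreover have "i < m ^ i"
      using assms less_exp[of i] power_mono[of 2 m i] by linarith
    ultimately show ?thesis using that by linarith
  qed
  then have "{M :: nat multiset. size M = k \<and> (\<Sum>i\<in>#M. m ^ i) = n} = mary_partitions m (Suc n) n k"
    unfolding mary_partitions_def by blast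
  then show ?thesis
    using mary_partition_gf_has_prod(2)[OF assms, of n] coeff_mary_partial_product[of m "Suc n" n k] assms
    by simp
qed

end

theory Submission
  imports Defs
begin

text \<open>
  The functional equation \<open>(1 - t q) P(q) = P(q\<^sup>m)\<close> gives \<open>p(n) = t\<^sup>j a(l)\<close> for \<open>n = m l + j\<close> with
  \<open>j < m\<close>, where \<open>a(k) = p(m k)\<close> satisfies \<open>a(k) = t\<^sup>m a(k - 1) + p(k)\<close>. If \<open>\<bar>t\<bar>\<^sup>m \<ge> 4\<close>, put
  \<open>R = \<bar>t\<bar>\<^sup>m / 2\<close>; then \<open>R \<ge> \<bar>t\<bar>\<close>, because \<open>R\<^sup>2 \<ge> \<bar>t\<bar>\<^sup>m \<ge> \<bar>t\<bar>\<^sup>2\<close>. Inductively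
  \<open>\<bar>a(k)\<bar> \<ge> R \<bar>a(k - 1)\<bar>\<close>: the growth obtained so far bounds the perturbation \<open>\<bar>p(k)\<bar>\<close> by
  \<open>R \<bar>a(k - 1)\<bar>\<close>, which is half of \<open>\<bar>t\<^sup>m a(k - 1)\<bar>\<close>. So no \<open>a(k)\<close>, and hence no \<open>p(n)\<close>, vanishes.
\<close>

lemma fps_nth_compose_X_power:
  fixes F :: "'a :: comm_ring_1 fps"
  assumes "m > 0"
  shows "fps_nth (F oo fps_X ^ m) n = (if m dvd n then fps_nth F (n div m) else 0)"
proof -
  have "fps_nth (F oo fps_X ^ m) n = (\<Sum>i=0..n. if n = m * i then fps_nth F i else 0)"
    by (auto simp: fps_compose_nth fps_X_power_nth simp flip: power_mult intro!: sum.cong)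
  also have "\<dots> = (\<Sum>i=0..n. if i = n div m then (if m dvd n then fps_nth F i else 0) else 0)"
    using assms by (intro sum.cong) auto
  also have "\<dots> = (if m dvd n then fps_nth F (n div m) else 0)"
    by simp
  finally show ?thesis .
qed

text \<open>Substituting \<open>q^m\<close> for \<open>q\<close> carries each factor of the product
  to the next one; the functional equation rests on this self-similarity.\<close>

lemma mary_factor_mult:
  assumes "m > 0" "k > 0"
  shows "mary_factor (m * k) = mary_factor k oo fps_X ^ m"
proof (rule fps_ext)
  fix n
  show "fps_nth (mary_factor (m * k)) n = fps_nth (mary_factor k oo fps_X ^ m) n"
  proof (cases "m dvd n")
    case True
    then obtain c where "n = m * c" ..
    then show ?thesis using assms by (simp add: mary_factor_nth fps_nth_compose_X_power)
  next
    case False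
    then have "\<not> m * k dvd n" by (meson dvd_mult_left)
    then show ?thesis using assms False by (simp add: mary_factor_nth fps_nth_compose_X_power)
  qed
qed

text \<open>The factor with \<open>j = 0\<close> cancels against \<open>1 - t q\<close>, and the
  others arise by substitution. Truncating keeps the products finite, so composition distributes
  over them.\<close>

lemma mary_partial_product_functional_equation:
  assumes "m \<ge> 2"
  shows "(1 - fps_const [:0, 1:] * fps_X) * (\<Prod>j<Suc N. mary_factor (m ^ j)) =
    (\<Prod>j<N. mary_factor (m ^ j)) oo fps_X ^ m"
proof -
  have "(\<Prod>j<Suc N. mary_factor (m ^ j)) = mary_factor 1 * (\<Prod>j<N. mary_factor (m * m ^ j))"
    by (simp only: prod.lessThan_Suc_shift power_0 power_Suc)
  also have "(\<Prod>j<N. mary_factor (m * m ^ j)) = (\<Prod>j<N. mary_factor (m ^ j) oo fps_X ^ m)"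
    using assms by (simp add: mary_factor_mult)
  also have "\<dots> = (\<Prod>j<N. mary_factor (m ^ j)) oo fps_X ^ m"
    using assms by (simp add: fps_compose_prod_distrib)
  finally show ?thesis
    using mary_factor_inverse[of 1] by (simp flip: mult.assoc)
qed

lemma mary_partition_poly_0:
  assumes "m \<ge> 2"
  shows "mary_partition_poly m 0 = 1"
  using mary_partition_gf_has_prod(2)[OF assms, of 0] by (simp add: mary_factor_nth)

lemma mary_partition_poly_Suc:
  assumes "m \<ge> 2"
  shows "mary_partition_poly m (Suc n) = [:0, 1:] * mary_partition_poly m n +
    (if m dvd Suc n then mary_partition_poly m (Suc n div m) else 0)"
proof -
  define Q where "Q N = (\<Prod>j<N. mary_factor (m ^ j))" for N
  have p: "mary_partition_poly m i = fps_nth (Q N) i" if "i < N" for i N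
    using mary_partition_gf_has_prod(2)[OF assms] mary_partial_product_stable[OF assms that]
    by (simp add: Q_def)
  \<comment> \<open>Both truncations are long enough that the coefficients compared, at
    \<open>Suc n\<close>, \<open>n\<close> and \<open>Suc n div m\<close>, are those of the infinite
    product.\<close>
  have "Q (Suc (Suc (Suc n))) =
      fps_const [:0, 1:] * (fps_X * Q (Suc (Suc (Suc n)))) + (Q (Suc (Suc n)) oo fps_X ^ m)"
    using mary_partial_product_functional_equation[OF assms, of "Suc (Suc n)", folded Q_def]
    by (simp only: left_diff_distrib mult_1_left mult.assoc diff_eq_eq add.commute)
  then have "fps_nth (Q (Suc (Suc (Suc n)))) (Suc n) =
      fps_nth (fps_const [:0, 1:] * (fps_X * Q (Suc (Suc (Suc n)))) + (Q (Suc (Suc n)) oo fps_X ^ m)) (Suc n)"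
    by (rule arg_cong)
  also have "\<dots> = [:0, 1:] * fps_nth (Q (Suc (Suc (Suc n)))) n +
      (if m dvd Suc n then fps_nth (Q (Suc (Suc n))) (Suc n div m) else 0)"
    using assms by (simp add: fps_nth_compose_X_power)
  finally show ?thesis
    using assms by (simp add: p[symmetric] le_imp_less_Suc)
qed

text \<open>Strictly between consecutive multiples of \<open>m\<close> the divisibility term of the
  recurrence vanishes, so each step only multiplies by \<open>t\<close>.\<close>

lemma poly_mary_partition_poly_mult_add:
  assumes "m \<ge> 2" "j < m"
  shows "poly (mary_partition_poly m (m * l + j)) t = t ^ j * poly (mary_partition_poly m (m * l)) t"
  using assms(2)
proof (induction j)
  case (Suc j)
  have "\<not> m dvd m * l + Suc j"
    using Suc.prems by (metis dvd_add_right_iff dvd_triv_left nat_dvd_not_less zero_less_Suc)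
  then show ?case
    using Suc mary_partition_poly_Suc[OF assms(1), of "m * l + j"] by simp
qed simp

lemma poly_mary_partition_poly_mult_Suc:
  assumes "m \<ge> 2"
  shows "poly (mary_partition_poly m (m * Suc k)) t =
    t ^ m * poly (mary_partition_poly m (m * k)) t + poly (mary_partition_poly m (Suc k)) t"
proof -
  obtain j where j: "m = Suc j" using assms by (cases m) auto
  have eq: "Suc (m * k + j) = m * Suc k" using j by simp
  have "poly (mary_partition_poly m (m * Suc k)) t =
      t * poly (mary_partition_poly m (m * k + j)) t + poly (mary_partition_poly m (Suc k)) t"
    using mary_partition_poly_Suc[OF assms, of "m * k + j"] assms unfolding eq by simp
  also have "poly (mary_partition_poly m (m * k + j)) t = t ^ j * poly (mary_partition_poly m (m * k)) t"
    using j by (intro poly_mary_partition_poly_mult_add[OF assms]) simp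
  finally show ?thesis by (simp add: j)
qed

lemma mary_partition_poly_growth:
  fixes t :: complex
  assumes m: "m \<ge> 2" and t: "norm t ^ m \<ge> 4"
  shows "norm (poly (mary_partition_poly m (m * Suc k)) t) \<ge>
    norm t ^ m / 2 * norm (poly (mary_partition_poly m (m * k)) t)"
proof (induction k rule: less_induct)
  case (less k)
  define a where "a k = norm (poly (mary_partition_poly m (m * k)) t)" for k
  define R where "R = norm t ^ m / 2"
  define l j where "l = Suc k div m" and "j = Suc k mod m"
  have lj: "Suc k = m * l + j" "j < m" using m by (simp_all add: l_def j_def)
  have l: "l \<le> k" using m div_less_dividend[of m "Suc k"] by (simp add: l_def del: div_less_dividend)
  have "norm t \<ge> 1"
    using t power_le_one[of "norm t" m] by (cases "norm t \<le> 1") auto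
  then have "norm t ^ 2 \<le> norm t ^ m" using m by (rule power_increasing[rotated])
  also have "\<dots> \<le> R ^ 2"
    using t mult_left_mono[OF t, of "norm t ^ m"] by (simp add: R_def power2_eq_square)
  finally have tR: "norm t \<le> R"
    using t by (auto intro: power2_le_imp_le simp: R_def)
  have R: "R \<ge> 1" using t by (simp add: R_def)
  \<comment> \<open>Iterates the induction hypothesis from \<open>l\<close> up to
    \<open>k\<close>.\<close>
  have growth: "R ^ i * a l \<le> a (l + i)" if "l + i \<le> k" for i
    using that
  proof (induction i)
    case (Suc i)
    have "R ^ Suc i * a l \<le> R * a (l + i)"
      using Suc R by (simp add: mult.assoc mult_left_mono)
    also have "\<dots> \<le> a (l + Suc i)"
      using less.IH[of "l + i"] Suc.prems by (simp add: a_def R_def)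
    finally show ?case .
  qed simp
  \<comment> \<open>From \<open>Suc k = m * l + j\<close> follows \<open>l + j \<le> Suc k\<close>.
    Hence \<open>R ^ j\<close> costs at most one factor \<open>R\<close> more than the growth from
    \<open>a l\<close> to \<open>a k\<close> supplies.\<close>
  have "m * l \<ge> l" using m by simp
  then have "j \<le> Suc (k - l)" using lj l by linarith
  have "norm (poly (mary_partition_poly m (Suc k)) t) = norm t ^ j * a l"
    unfolding lj(1) poly_mary_partition_poly_mult_add[OF m lj(2)]
    by (simp add: a_def norm_mult norm_power)
  also have "\<dots> \<le> R ^ j * a l"
    using tR by (intro mult_right_mono power_mono) (auto simp: a_def)
  also have "\<dots> \<le> R ^ Suc (k - l) * a l"
    using R \<open>j \<le> Suc (k - l)\<close> by (intro mult_right_mono power_increasing) (auto simp: a_def)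
  also have "\<dots> \<le> R * a k"
    using growth[of "k - l"] l R by (simp add: mult.assoc)
  finally have "norm (poly (mary_partition_poly m (Suc k)) t) \<le> R * a k" .
  moreover have "norm (t ^ m * poly (mary_partition_poly m (m * k)) t) = 2 * (R * a k)"
    by (simp add: norm_mult norm_power R_def a_def)
  \<comment> \<open>By the reverse triangle inequality at least
    \<open>2 * (R * a k) - R * a k\<close> remains.\<close>
  ultimately show ?case
    unfolding poly_mary_partition_poly_mult_Suc[OF m]
    using norm_diff_ineq[of "t ^ m * poly (mary_partition_poly m (m * k)) t"
        "poly (mary_partition_poly m (Suc k)) t"]
    by (simp add: R_def a_def)
qed

lemma poly_mary_partition_poly_nonzero:
  fixes t :: complex
  assumes m: "m \<ge> 2" and t: "norm t ^ m \<ge> 4"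
  shows "poly (mary_partition_poly m n) t \<noteq> 0"
proof -
  have "norm (poly (mary_partition_poly m (m * k)) t) > 0" for k
  proof (induction k)
    case 0
    show ?case by (simp add: mary_partition_poly_0[OF m])
  next
    case (Suc k)
    have "0 < norm t ^ m / 2 * norm (poly (mary_partition_poly m (m * k)) t)"
      using Suc t by (intro mult_pos_pos) auto
    also note mary_partition_poly_growth[OF m t]
    finally show ?case .
  qed
  \<comment> \<open>Needed for the factor \<open>t ^ (n mod m)\<close> that separates
    \<open>n\<close> from the multiple of \<open>m\<close> below it.\<close>
  moreover have "t \<noteq> 0" using t m by (auto simp: power_0_left)
  ultimately show ?thesis
    using poly_mary_partition_poly_mult_add[OF m, of "n mod m" "n div m" t] m by simp
qed

theorem theorem4p3:
  fixes m n :: nat and t :: complex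
  assumes "m \<ge> 2"
    and "poly (mary_partition_poly m n) t = 0"
  shows "norm t < 4 powr (1 / real m)"
proof -
  have "norm t ^ m < 4"
    using poly_mary_partition_poly_nonzero[OF assms(1)] assms(2) by force
  also have "(4 :: real) = (4 powr (1 / real m)) ^ m"
    using assms(1) by (simp add: powr_realpow[symmetric] powr_powr)
  finally show ?thesis by (rule power_less_imp_less_base) simp
qed

end
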